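(* Let $G=(G_1,\dots,G_n)$ be a mean zero Gaussian vector with infinitely divisible squares, whose covariance matrix $\Gamma$ is strictly positive definite and irreducible and such that $\Gamma^{-1}$ is an $M$-matrix. Let $D_i=\sum_{k=1}^n(\Gamma^{-1})_{i,k}$ and $\mathcal D=\{(i,j): D_iD_j<0\}$. If $\mathcal D\neq\emptyset$ and $\alpha_0$ is a critical point of $G$, then $$\alpha_0\le \inf_{(i,j)\in\mathcal D}\Big(\frac{(\Gamma^{-1})_{i,j}}{2D_iD_j}\Big)^{1/2}.$$
   Context: A random vector $G$ has infinitely divisible squares if for every $m\in\mathbb N$, $G^2=(G_1^2,\dots,G_n^2)$ equals in law a sum of $m$ i.i.d. random vectors. For $\alpha\in\mathbb R$, $(G+\alpha\mathbf 1)^2=((G_1+\alpha)^2,\dots,(G_n+\alpha)^2)$. A real number $0<\alpha_0<\infty$ is a critical point of $G$ if $(G+\alpha\mathbf 1)^2$ is infinitely divisible for all $|\alpha|\le\alpha_0$ and not infinitely divisible for any $|\alpha|>\alpha_0$; if $(G+\alpha\mathbf 1)^2$ is infinitely divisible for all $\alpha$, $G$ has no critical point. A non-singular matrix $A$ is an $M$-matrix if all entries of $A^{-1}$ are non-negative and $A_{i,j}\le0$ for $i\ne j$. A symmetric matrix is irreducible if it is not a direct sum of square matrices. *)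

theory Defs
  imports "HOL-Probability.Probability"
begin

fun conv_pow :: "('a::ordered_euclidean_space) measure \<Rightarrow> nat \<Rightarrow> 'a measure" where
  "conv_pow \<mu> 0 = return borel 0"
| "conv_pow \<mu> (Suc 0) = \<mu>"
| "conv_pow \<mu> (Suc (Suc k)) = convolution \<mu> (conv_pow \<mu> (Suc k))"

definition inf_divisible :: "('a::ordered_euclidean_space) measure \<Rightarrow> bool" where
  "inf_divisible \<nu> \<longleftrightarrow> (\<forall>m::nat. m \<ge> 1 \<longrightarrow>
     (\<exists>\<mu>. prob_space \<mu> \<and> sets \<mu> = sets borel \<and> conv_pow \<mu> m = \<nu>))"

definition shifted_sq_law ::
  "'s measure \<Rightarrow> ('s \<Rightarrow> real^'n) \<Rightarrow> real \<Rightarrow> (real^'n) measure" where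
  "shifted_sq_law M G \<alpha> = distr M borel (\<lambda>\<omega>. \<chi> i. (G \<omega> $ i + \<alpha>)\<^sup>2)"

definition critical_point :: "'s measure \<Rightarrow> ('s \<Rightarrow> real^'n) \<Rightarrow> real \<Rightarrow> bool" where
  "critical_point M G \<alpha>0 \<longleftrightarrow> 0 < \<alpha>0 \<and>
     (\<forall>\<alpha>. \<bar>\<alpha>\<bar> \<le> \<alpha>0 \<longrightarrow> inf_divisible (shifted_sq_law M G \<alpha>)) \<and>
     (\<forall>\<alpha>. \<bar>\<alpha>\<bar> > \<alpha>0 \<longrightarrow> \<not> inf_divisible (shifted_sq_law M G \<alpha>))"

definition centered_gaussian_vector ::
  "'s measure \<Rightarrow> ('s \<Rightarrow> real^'n) \<Rightarrow> real^'n^'n \<Rightarrow> bool" where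
  "centered_gaussian_vector M G \<Gamma> \<longleftrightarrow> prob_space M \<and> G \<in> borel_measurable M \<and>
     (\<forall>a. (a \<bullet> (\<Gamma> *v a) > 0 \<longrightarrow>
            distributed M lborel (\<lambda>\<omega>. a \<bullet> G \<omega>)
              (\<lambda>x. ennreal (normal_density 0 (sqrt (a \<bullet> (\<Gamma> *v a))) x))) \<and>
          (a \<bullet> (\<Gamma> *v a) = 0 \<longrightarrow> (AE \<omega> in M. a \<bullet> G \<omega> = 0)))"

definition strictly_pos_def :: "real^'n^'n \<Rightarrow> bool" where
  "strictly_pos_def A \<longleftrightarrow> transpose A = A \<and> (\<forall>x. x \<noteq> 0 \<longrightarrow> x \<bullet> (A *v x) > 0)"

text \<open>A symmetric matrix is irreducible if it is not (up to a simultaneous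
  permutation of rows and columns) a direct sum of square matrices.\<close>
definition irreducible_mat :: "real^'n^'n \<Rightarrow> bool" where
  "irreducible_mat A \<longleftrightarrow> \<not> (\<exists>I J. I \<noteq> {} \<and> J \<noteq> {} \<and> I \<inter> J = {} \<and> I \<union> J = UNIV \<and>
        (\<forall>i\<in>I. \<forall>j\<in>J. A $ i $ j = 0 \<and> A $ j $ i = 0))"

definition M_matrix :: "real^'n^'n \<Rightarrow> bool" where
  "M_matrix A \<longleftrightarrow> invertible A \<and> (\<forall>i j. matrix_inv A $ i $ j \<ge> 0) \<and>
     (\<forall>i j. i \<noteq> j \<longrightarrow> A $ i $ j \<le> 0)"

end

theory Submission
  imports Defs
begin

text \<open>
  Write A for the inverse of \<Gamma>, X = G + \<alpha>1 and D = A1. Weighting the law of X by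
  exp (- (\<Sum>k. l k * (X k)^2) / 2) keeps it Gaussian, with covariance C = (A + diag l)^-1 and mean
  m = \<alpha>CD. This is shown one coordinate at a time: writing exp (- s x^2 / 2) as the characteristic
  function of a standard normal variable reduces the step to a one-dimensional Gaussian integral.

  On the other hand, the logarithm of the Laplace transform \<phi> of an infinitely divisible vector with
  nonnegative entries has nonnegative mixed differences, since m (\<phi>^(1/m) - 1) tends to ln \<phi> and
  \<phi>^(1/m) is again a Laplace transform. For the squares of X this says that
  C i j ^ 2 + 2 m i m j C i j \<ge> 0. Irreducibility makes C i j positive, so it can be cancelled.
  Finally take l = t1: as t tends to infinity, t^2 C i j tends to - A i j and t m tends to \<alpha>D, which
  gives - A i j + 2 \<alpha>^2 D i D j \<ge> 0.
\<close>

section \<open>Laplace transforms of infinitely divisible laws\<close>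

lemma conv_pow_prob:
  fixes \<mu> :: "'a::ordered_euclidean_space measure"
  assumes "prob_space \<mu>" and [measurable_cong, simp]: "sets \<mu> = sets borel"
  shows "prob_space (conv_pow \<mu> m)" "sets (conv_pow \<mu> m) = sets borel"
proof -
  interpret prob_space \<mu> by fact
  have "prob_space (conv_pow \<mu> m) \<and> sets (conv_pow \<mu> m) = sets borel"
  proof (induction m)
    case 0
    show ?case by (simp add: prob_space_return)
  next
    case (Suc m)
    show ?case
    proof (cases m)
      case 0
      then show ?thesis using assms by simp
    next
      case (Suc k)
      note [measurable_cong] = Suc.IH[THEN conjunct2, unfolded Suc]
      interpret N: prob_space "conv_pow \<mu> (Suc k)"
        using Suc.IH[THEN conjunct1, unfolded Suc] .
      interpret pair_prob_space \<mu> "conv_pow \<mu> (Suc k)" ..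
      show ?thesis
        unfolding Suc by (simp add: convolution_def) (intro prob_space_distr, simp)
    qed
  qed
  then show "prob_space (conv_pow \<mu> m)" "sets (conv_pow \<mu> m) = sets borel" by auto
qed

text \<open>Fubini and induction. An inequality for \<open>f\<close>, rather than an identity, lets
  \<open>f\<close> be the indicator of a half-space \<open>x $ j < 0\<close>, which is stable under
  addition: if it is null for the convolution power, it is null for \<open>\<mu>\<close>.\<close>

lemma nn_integral_conv_pow_ge:
  fixes \<mu> :: "'a::ordered_euclidean_space measure" and f :: "'a \<Rightarrow> ennreal"
  assumes "prob_space \<mu>" and [measurable_cong, simp]: "sets \<mu> = sets borel"
    and [measurable]: "f \<in> borel_measurable borel"
    and mult: "\<And>x y. f x * f y \<le> f (x + y)"
  shows "(\<integral>\<^sup>+x. f x \<partial>\<mu>) ^ Suc m \<le> (\<integral>\<^sup>+x. f x \<partial>conv_pow \<mu> (Suc m))"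
proof (induction m)
  case (Suc m)
  let ?N = "conv_pow \<mu> (Suc m)"
  note N = conv_pow_prob[OF assms(1,2), of "Suc m"]
  note [measurable_cong, simp] = N(2)
  have "(\<integral>\<^sup>+x. f x \<partial>\<mu>) ^ Suc (Suc m) \<le> (\<integral>\<^sup>+x. f x \<partial>\<mu>) * (\<integral>\<^sup>+x. f x \<partial>?N)"
    using Suc.IH by (simp add: mult_left_mono)
  also have "\<dots> = (\<integral>\<^sup>+x. \<integral>\<^sup>+y. f x * f y \<partial>?N \<partial>\<mu>)"
    by (simp add: nn_integral_cmult nn_integral_multc)
  also have "\<dots> \<le> (\<integral>\<^sup>+x. \<integral>\<^sup>+y. f (x + y) \<partial>?N \<partial>\<mu>)"
    by (intro nn_integral_mono mult)
  also have "\<dots> = (\<integral>\<^sup>+x. f x \<partial>conv_pow \<mu> (Suc (Suc m)))"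
    using assms(1) N(1) by (simp add: nn_integral_convolution prob_space.axioms(1))
  finally show ?case .
qed simp

text \<open>Meant for the kernels \<open>exp (- (l \<bullet> x))\<close>: the Laplace transform of a
  convolution power is the power of the Laplace transform. Values in \<open>ennreal\<close> spare
  any integrability argument.\<close>

lemma nn_integral_conv_pow_eq:
  fixes \<mu> :: "'a::ordered_euclidean_space measure" and f :: "'a \<Rightarrow> ennreal"
  assumes "prob_space \<mu>" and [measurable_cong, simp]: "sets \<mu> = sets borel"
    and [measurable]: "f \<in> borel_measurable borel"
    and mult: "\<And>x y. f (x + y) = f x * f y"
  shows "(\<integral>\<^sup>+x. f x \<partial>conv_pow \<mu> (Suc m)) = (\<integral>\<^sup>+x. f x \<partial>\<mu>) ^ Suc m"
proof (induction m)
  case (Suc m)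
  let ?N = "conv_pow \<mu> (Suc m)"
  note N = conv_pow_prob[OF assms(1,2), of "Suc m"]
  note [measurable_cong, simp] = N(2)
  have "(\<integral>\<^sup>+x. f x \<partial>conv_pow \<mu> (Suc (Suc m))) = (\<integral>\<^sup>+x. \<integral>\<^sup>+y. f x * f y \<partial>?N \<partial>\<mu>)"
    using assms(1) N(1) by (simp add: nn_integral_convolution prob_space.axioms(1) mult)
  also have "\<dots> = (\<integral>\<^sup>+x. f x \<partial>\<mu>) * (\<integral>\<^sup>+x. f x \<partial>?N)"
    by (simp add: nn_integral_cmult nn_integral_multc)
  finally show ?case using Suc.IH by simp
qed simp

text \<open>A convolution root is a priori a law on the whole space. That it lives on nonnegative
  vectors follows since the \<open>m\<close>-th power of its mass on \<open>x $ j < 0\<close> is at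
  most the mass under \<open>\<nu>\<close>, which is 0. This later bounds its Laplace
  transform.\<close>

lemma inf_divisible_root:
  fixes \<nu> :: "(real^'n) measure"
  assumes "inf_divisible \<nu>" and "m \<ge> 1" and pos: "AE x in \<nu>. \<forall>k. 0 \<le> x $ k"
  obtains \<mu> where "prob_space \<mu>" "sets \<mu> = sets borel" "AE x in \<mu>. \<forall>k. 0 \<le> x $ k"
    "\<And>l. (\<integral>\<^sup>+x. ennreal (exp (- (l \<bullet> x))) \<partial>\<nu>) = (\<integral>\<^sup>+x. ennreal (exp (- (l \<bullet> x))) \<partial>\<mu>) ^ m"
proof -
  from assms obtain \<mu> where \<mu>: "prob_space \<mu>" "sets \<mu> = sets borel" "conv_pow \<mu> m = \<nu>"
    unfolding inf_divisible_def by blast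
  note [measurable_cong, simp] = \<mu>(2)
  obtain k where m: "m = Suc k" using \<open>m \<ge> 1\<close> by (cases m) auto
  have \<nu>[measurable_cong, simp]: "sets \<nu> = sets borel"
    using conv_pow_prob(2)[OF \<mu>(1,2), of m] \<mu>(3) by simp
  have "AE x in \<mu>. 0 \<le> x $ j" for j
  proof -
    let ?f = "indicator {x. x $ j < 0} :: real^'n \<Rightarrow> ennreal"
    have [measurable]: "{x::real^'n. x $ j < 0} \<in> sets borel"
      by measurable
    have "(\<integral>\<^sup>+x. ?f x \<partial>\<mu>) ^ m \<le> (\<integral>\<^sup>+x. ?f x \<partial>\<nu>)"
      unfolding m \<mu>(3)[symmetric]
      by (rule nn_integral_conv_pow_ge) (auto simp: \<mu> split: split_indicator)
    also have "\<dots> = (\<integral>\<^sup>+x. 0 \<partial>\<nu>)"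
      using pos by (intro nn_integral_cong_AE) (auto split: split_indicator simp: not_less)
    finally have "emeasure \<mu> {x. x $ j < 0} = 0" using m by auto
    then show ?thesis
      by (intro AE_I[of _ _ "{x. x $ j < 0}"]) auto
  qed
  then have "AE x in \<mu>. \<forall>j. 0 \<le> x $ j" by (simp add: AE_all_countable)
  moreover have "(\<integral>\<^sup>+x. ennreal (exp (- (l \<bullet> x))) \<partial>\<nu>) = (\<integral>\<^sup>+x. ennreal (exp (- (l \<bullet> x))) \<partial>\<mu>) ^ m" for l
    unfolding m \<mu>(3)[symmetric]
    by (rule nn_integral_conv_pow_eq)
       (auto simp: \<mu> inner_add_right ennreal_mult'[symmetric] exp_add[symmetric])
  ultimately show thesis using that \<mu> by blast
qed

text \<open>The derivative at h = 0 of x to the power h is \<open>ln x\<close>; the sequence is its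
  difference quotient along h = 1/(m+1).\<close>

lemma tendsto_root_ln:
  assumes "0 < (x::real)"
  shows "(\<lambda>m. real (Suc m) * (root (Suc m) x - 1)) \<longlonglongrightarrow> ln x"
proof -
  have "((\<lambda>h. exp (h * ln x)) has_field_derivative ln x) (at 0)"
    by (auto intro!: derivative_eq_intros)
  then have "((\<lambda>h. (exp (h * ln x) - 1) / h) \<longlongrightarrow> ln x) (at 0)"
    by (simp add: has_field_derivative_iff)
  moreover have "filterlim (\<lambda>m. inverse (real (Suc m))) (at 0) sequentially"
    using LIMSEQ_inverse_real_of_nat by (auto simp: filterlim_at simp del: of_nat_Suc)
  ultimately have "(\<lambda>m. (exp (inverse (real (Suc m)) * ln x) - 1) / (inverse (real (Suc m)))) \<longlonglongrightarrow> ln x"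
    by (auto dest: filterlim_compose simp: o_def)
  moreover have "root (Suc m) x = exp (inverse (real (Suc m)) * ln x)" for m
    using assms root_powr_inverse[of "Suc m" x] by (simp add: powr_def divide_simps)
  ultimately show ?thesis by (simp add: field_simps)
qed

text \<open>The product \<open>exp (- (l \<bullet> x)) * (1 - exp (- (p \<bullet> x))) * (1 - exp (-
  (q \<bullet> x)))\<close> is nonnegative on nonnegative vectors. Integrated against a convolution
  root of order m+1, it gives the inequality for the (m+1)-th roots of \<phi>; scaling by m+1 and
  passing to the limit turns roots into logarithms.\<close>

lemma inf_divisible_ln_laplace:
  fixes \<nu> :: "(real^'n) measure" and l p q :: "real^'n"
  defines "\<phi> \<equiv> (\<lambda>l. \<integral>x. exp (- (l \<bullet> x)) \<partial>\<nu>)"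
  assumes id: "inf_divisible \<nu>" and pos: "AE x in \<nu>. \<forall>k. 0 \<le> x $ k"
    and l: "\<And>k. 0 \<le> l $ k" "\<And>k. 0 \<le> p $ k" "\<And>k. 0 \<le> q $ k"
    and \<phi>_pos: "0 < \<phi> l" "0 < \<phi> (l + p)" "0 < \<phi> (l + q)" "0 < \<phi> (l + p + q)"
  shows "ln (\<phi> (l + p)) + ln (\<phi> (l + q)) \<le> ln (\<phi> l) + ln (\<phi> (l + p + q))"
proof -
  have *: "root (Suc m) (\<phi> (l + p)) + root (Suc m) (\<phi> (l + q))
      \<le> root (Suc m) (\<phi> l) + root (Suc m) (\<phi> (l + p + q))" for m
  proof -
    obtain \<mu> where \<mu>: "prob_space \<mu>" "sets \<mu> = sets borel" "AE x in \<mu>. \<forall>k. 0 \<le> x $ k"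
      and lap: "\<And>l. (\<integral>\<^sup>+x. ennreal (exp (- (l \<bullet> x))) \<partial>\<nu>) = (\<integral>\<^sup>+x. ennreal (exp (- (l \<bullet> x))) \<partial>\<mu>) ^ Suc m"
      using inf_divisible_root[OF id _ pos, of "Suc m"] by auto
    interpret prob_space \<mu> by fact
    note [measurable_cong, simp] = \<mu>(2)
    have \<nu>[measurable_cong, simp]: "sets \<nu> = sets borel"
      using id conv_pow_prob(2) unfolding inf_divisible_def by (metis order_refl)
    have int: "integrable \<mu> (\<lambda>x. exp (- (l \<bullet> x)))" if "\<And>k. 0 \<le> l $ k" for l
    proof (rule integrable_const_bound[where B = 1])
      show "AE x in \<mu>. norm (exp (- (l \<bullet> x))) \<le> 1"
        using \<mu>(3) by eventually_elim (auto simp: inner_vec_def that intro!: sum_nonneg)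
    qed simp
    have rt: "root (Suc m) (\<phi> l) = (\<integral>x. exp (- (l \<bullet> x)) \<partial>\<mu>)" if "\<And>k. 0 \<le> l $ k" for l
    proof -
      have "\<phi> l = enn2real (\<integral>\<^sup>+x. ennreal (exp (- (l \<bullet> x))) \<partial>\<nu>)"
        unfolding \<phi>_def by (rule integral_eq_nn_integral) auto
      also have "\<dots> = (\<integral>x. exp (- (l \<bullet> x)) \<partial>\<mu>) ^ Suc m"
        unfolding lap by (subst nn_integral_eq_integral[OF int[OF that]])
          (auto simp flip: ennreal_mult' simp del: power_Suc simp: ennreal_power)
      finally show ?thesis by (simp add: real_root_power_cancel del: power_Suc)
    qed
    have "0 \<le> (\<integral>x. exp (- (l \<bullet> x)) * (1 - exp (- (p \<bullet> x))) * (1 - exp (- (q \<bullet> x))) \<partial>\<mu>)"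
    proof (rule integral_nonneg_AE)
      show "AE x in \<mu>. 0 \<le> exp (- (l \<bullet> x)) * (1 - exp (- (p \<bullet> x))) * (1 - exp (- (q \<bullet> x)))"
        using \<mu>(3) by eventually_elim (auto simp: inner_vec_def l intro!: sum_nonneg mult_nonneg_nonneg)
    qed
    also have "\<dots> = (\<integral>x. exp (- (l \<bullet> x)) - exp (- ((l + p) \<bullet> x)) - exp (- ((l + q) \<bullet> x))
        + exp (- ((l + p + q) \<bullet> x)) \<partial>\<mu>)"
      by (simp add: inner_add_left exp_diff exp_minus exp_add divide_inverse algebra_simps)
    also have "\<dots> = root (Suc m) (\<phi> l) - root (Suc m) (\<phi> (l + p)) - root (Suc m) (\<phi> (l + q))
        + root (Suc m) (\<phi> (l + p + q))"
      using l by (simp add: rt int)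
    finally show ?thesis by simp
  qed
  show ?thesis
  proof (rule LIMSEQ_le)
    show "(\<lambda>m. real (Suc m) * (root (Suc m) (\<phi> (l + p)) - 1) + real (Suc m) * (root (Suc m) (\<phi> (l + q)) - 1))
      \<longlonglongrightarrow> ln (\<phi> (l + p)) + ln (\<phi> (l + q))"
      by (intro tendsto_add tendsto_root_ln \<phi>_pos)
    show "(\<lambda>m. real (Suc m) * (root (Suc m) (\<phi> l) - 1) + real (Suc m) * (root (Suc m) (\<phi> (l + p + q)) - 1))
      \<longlonglongrightarrow> ln (\<phi> l) + ln (\<phi> (l + p + q))"
      by (intro tendsto_add tendsto_root_ln \<phi>_pos)
    \<comment> \<open>Each side contains -1 twice, so the inequality between the roots survives the
      normalisation.\<close>
    have "real (Suc m) * (root (Suc m) (\<phi> (l + p)) - 1) + real (Suc m) * (root (Suc m) (\<phi> (l + q)) - 1)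
      \<le> real (Suc m) * (root (Suc m) (\<phi> l) - 1) + real (Suc m) * (root (Suc m) (\<phi> (l + p + q)) - 1)" for m
      unfolding distrib_left[symmetric] using *[of m] by (intro mult_left_mono) auto
    then show "\<exists>N. \<forall>m\<ge>N. real (Suc m) * (root (Suc m) (\<phi> (l + p)) - 1) + real (Suc m) * (root (Suc m) (\<phi> (l + q)) - 1)
      \<le> real (Suc m) * (root (Suc m) (\<phi> l) - 1) + real (Suc m) * (root (Suc m) (\<phi> (l + p + q)) - 1)" by blast
  qed
qed

section \<open>Gaussian vectors weighted by exponentials of squares\<close>

lemma borel_measurable_vec_component[measurable (raw)]:
  fixes f :: "'s \<Rightarrow> real^'n"
  shows "f \<in> borel_measurable M \<Longrightarrow> (\<lambda>x. f x $ i) \<in> borel_measurable M"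
  by (rule measurable_compose[OF _ borel_measurable_nth])

text \<open>Completing the square: with the density, the real exponent is -(p x^2 / 2) - q x for p =
  1 + s. The substitution x = -q/p + y / sqrt p turns it into -y^2 / 2 + q^2 / (2p), and what
  remains is the characteristic function of the standard normal law at r / sqrt p.\<close>

lemma gaussian_integral_linear:
  fixes s q r :: real
  assumes "0 \<le> s"
  shows "(\<integral>x. exp (complex_of_real (- (s * x\<^sup>2 / 2) - q * x) + \<i> * of_real (r * x)) \<partial>std_normal_distribution)
    = of_real (exp ((q\<^sup>2 - r\<^sup>2) / (2 * (1 + s))) / sqrt (1 + s)) * exp (- \<i> * of_real (q * r / (1 + s)))"
proof -
  define p where "p = 1 + s"
  have p: "0 < p" using assms by (simp add: p_def)
  define K where "K = of_real (exp (q\<^sup>2 / (2 * p)) / sqrt p) * exp (- \<i> * of_real (q * r / p))"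
  have "(\<integral>x. exp (complex_of_real (- (s * x\<^sup>2 / 2) - q * x) + \<i> * of_real (r * x)) \<partial>std_normal_distribution)
    = (\<integral>x. std_normal_density x *\<^sub>R exp (complex_of_real (- (s * x\<^sup>2 / 2) - q * x) + \<i> * of_real (r * x)) \<partial>lborel)"
    by (subst integral_density) auto
  also have "\<dots> = (\<integral>x. (1 / sqrt (2 * pi)) *\<^sub>R exp (complex_of_real (- (p * x\<^sup>2 / 2) - q * x) + \<i> * of_real (r * x)) \<partial>lborel)"
    by (intro Bochner_Integration.integral_cong refl)
       (simp add: normal_density_def p_def scaleR_conv_of_real exp_of_real[symmetric] exp_add[symmetric],
        simp add: add_divide_distrib algebra_simps)
  also have "\<dots> = \<bar>1 / sqrt p\<bar> *\<^sub>R (\<integral>x. (1 / sqrt (2 * pi)) *\<^sub>R exp (complex_of_real (- (p * (- (q / p) + 1 / sqrt p * x)\<^sup>2 / 2)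
      - q * (- (q / p) + 1 / sqrt p * x)) + \<i> * of_real (r * (- (q / p) + 1 / sqrt p * x))) \<partial>lborel)"
    using p by (intro lborel_integral_real_affine) auto
  also have "\<dots> = \<bar>1 / sqrt p\<bar> *\<^sub>R (\<integral>x. (of_real (exp (q\<^sup>2 / (2 * p))) * exp (- \<i> * of_real (q * r / p)))
      * (std_normal_density x *\<^sub>R exp (\<i> * of_real ((r / sqrt p) * x))) \<partial>lborel)"
  proof (intro arg_cong[where f = "\<lambda>y. \<bar>1 / sqrt p\<bar> *\<^sub>R y"] Bochner_Integration.integral_cong refl)
    fix x
    have "- (p * (- (q / p) + 1 / sqrt p * x)\<^sup>2 / 2) - q * (- (q / p) + 1 / sqrt p * x)
      = - x\<^sup>2 / 2 + q\<^sup>2 / (2 * p)"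
    proof -
      have "p * (- (q / p) + 1 / sqrt p * x)\<^sup>2 = q\<^sup>2 / p - 2 * q * x / sqrt p + p * (x\<^sup>2 / (sqrt p)\<^sup>2)"
        using p by (simp add: power2_eq_square field_simps del: real_sqrt_pow2 real_sqrt_mult_self)
      also have "p * (x\<^sup>2 / (sqrt p)\<^sup>2) = x\<^sup>2" using p by simp
      finally show ?thesis using p by (simp add: field_simps power2_eq_square)
    qed
    then show "(1 / sqrt (2 * pi)) *\<^sub>R exp (complex_of_real (- (p * (- (q / p) + 1 / sqrt p * x)\<^sup>2 / 2)
      - q * (- (q / p) + 1 / sqrt p * x)) + \<i> * of_real (r * (- (q / p) + 1 / sqrt p * x)))
      = (of_real (exp (q\<^sup>2 / (2 * p))) * exp (- \<i> * of_real (q * r / p)))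
      * (std_normal_density x *\<^sub>R exp (\<i> * of_real ((r / sqrt p) * x)))"
      by (simp add: normal_density_def scaleR_conv_of_real exp_of_real[symmetric] exp_add[symmetric])
         (simp add: algebra_simps)
  qed
  also have "\<dots> = K * (\<integral>x. std_normal_density x *\<^sub>R exp (\<i> * of_real ((r / sqrt p) * x)) \<partial>lborel)"
    unfolding K_def integral_mult_right_zero using p by (simp add: scaleR_conv_of_real)
  also have "(\<integral>x. std_normal_density x *\<^sub>R exp (\<i> * of_real ((r / sqrt p) * x)) \<partial>lborel)
      = char std_normal_distribution (r / sqrt p)"
    unfolding char_def by (subst integral_density) auto
  also have "\<dots> = of_real (exp (- (r\<^sup>2 / (2 * p))))"
    using p by (simp add: char_std_normal_distribution power_divide)
  also have "K * of_real (exp (- (r\<^sup>2 / (2 * p))))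
    = of_real (exp ((q\<^sup>2 - r\<^sup>2) / (2 * p)) / sqrt p) * exp (- \<i> * of_real (q * r / p))"
    unfolding K_def by (simp add: diff_divide_distrib exp_diff exp_minus field_simps)
  finally show ?thesis unfolding p_def .
qed

text \<open>The measure with density W, of total mass c, makes X Gaussian with mean m and covariance C.\<close>

definition tilted_gaussian ::
  "'s measure \<Rightarrow> ('s \<Rightarrow> real^'n) \<Rightarrow> ('s \<Rightarrow> real) \<Rightarrow> real \<Rightarrow> real^'n \<Rightarrow> real^'n^'n \<Rightarrow> bool" where
  "tilted_gaussian M X W c m C \<longleftrightarrow>
     (\<forall>a. (\<integral>\<omega>. exp (\<i> * of_real (a \<bullet> X \<omega>)) * of_real (W \<omega>) \<partial>M)
        = of_real c * exp (\<i> * of_real (m \<bullet> a) - of_real (a \<bullet> (C *v a) / 2)))"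

text \<open>Effect of a further factor exp (- s * (X k)^2 / 2) on covariance, mean and mass; the covariance
  update is the Sherman--Morrison formula.\<close>

definition tilted_cov :: "real \<Rightarrow> 'n \<Rightarrow> real^'n^'n \<Rightarrow> real^'n^'n" where
  "tilted_cov s k C = (\<chi> i j. C $ i $ j - s * C $ i $ k * C $ j $ k / (1 + s * C $ k $ k))"

definition tilted_mean :: "real \<Rightarrow> 'n \<Rightarrow> real^'n^'n \<Rightarrow> real^'n \<Rightarrow> real^'n" where
  "tilted_mean s k C m = (\<chi> i. m $ i - s * m $ k * C $ i $ k / (1 + s * C $ k $ k))"

definition tilted_mass :: "real \<Rightarrow> 'n \<Rightarrow> real^'n^'n \<Rightarrow> real^'n \<Rightarrow> real \<Rightarrow> real" where
  "tilted_mass s k C m c =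
     c * exp (- (s * (m $ k)\<^sup>2 / (2 * (1 + s * C $ k $ k)))) / sqrt (1 + s * C $ k $ k)"

lemma inner_tilted_cov:
  "a \<bullet> (tilted_cov s k C *v a) = a \<bullet> (C *v a) - s * (\<Sum>i\<in>UNIV. C $ i $ k * a $ i)\<^sup>2 / (1 + s * C $ k $ k)"
  unfolding tilted_cov_def inner_vec_def matrix_vector_mult_def
  by (simp add: power2_eq_square sum_product sum_distrib_left sum_distrib_right left_diff_distrib right_diff_distrib
      sum_subtractf sum_divide_distrib mult_ac)

lemma inner_tilted_mean:
  "tilted_mean s k C m \<bullet> a = m \<bullet> a - s * m $ k * (\<Sum>i\<in>UNIV. C $ i $ k * a $ i) / (1 + s * C $ k $ k)"
  unfolding tilted_mean_def inner_vec_def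
  by (simp add: sum_distrib_left left_diff_distrib sum_subtractf sum_divide_distrib mult.assoc)

text \<open>With t = sqrt s, the new factor is the mean of exp (i t \<xi> X_k) over a standard
  normal \<xi>. By Fubini the inner integral is the known transform at the real point
  \<open>a + (t * \<xi>) *\<^sub>R e\<close>, and a Gaussian integral in \<xi> is left. The bounds
  on \<open>W\<close> give integrability, and \<open>Ck\<close> keeps
  \<open>1 + s * C $ k $ k\<close> positive.\<close>

lemma tilted_gaussian_step:
  fixes X :: "'s \<Rightarrow> real^'n"
  assumes "prob_space M" and X[measurable]: "X \<in> borel_measurable M"
    and W[measurable]: "W \<in> borel_measurable M" and W01: "\<And>\<omega>. 0 \<le> W \<omega>" "\<And>\<omega>. W \<omega> \<le> 1"
    and tg: "tilted_gaussian M X W c m C"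
    and sym: "transpose C = C" and Ck: "0 \<le> C $ k $ k" and s: "0 \<le> s"
  shows "tilted_gaussian M X (\<lambda>\<omega>. W \<omega> * exp (- (s * (X \<omega> $ k)\<^sup>2 / 2)))
    (tilted_mass s k C m c) (tilted_mean s k C m) (tilted_cov s k C)"
  unfolding tilted_gaussian_def
proof
  fix a :: "real^'n"
  interpret prob_space M by fact
  interpret N: real_distribution std_normal_distribution by (rule real_dist_normal_dist)
  interpret pair_prob_space M std_normal_distribution ..
  define t where "t = sqrt s"
  have t: "t\<^sup>2 = s" using s by (simp add: t_def)
  define b where "b = (\<Sum>i\<in>UNIV. C $ i $ k * a $ i)"
  define e where "e = (axis k 1 :: real^'n)"
  define p where "p = 1 + s * C $ k $ k"
  have sym': "C $ i $ j = C $ j $ i" for i j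
    using sym by (metis transpose_def vec_lambda_beta)
  have b1: "a \<bullet> (C *v e) = b"
    unfolding e_def by (simp add: matrix_vector_mult_basis column_def inner_vec_def b_def mult.commute)
  have b2: "e \<bullet> (C *v a) = b"
    unfolding e_def by (simp add: inner_axis' matrix_vector_mult_def b_def sym')
  have b3: "e \<bullet> (C *v e) = C $ k $ k"
    unfolding e_def by (simp add: inner_axis' matrix_vector_mult_basis column_def)
  have b4: "e \<bullet> X \<omega> = X \<omega> $ k" "m \<bullet> e = m $ k" for \<omega>
    by (simp_all add: e_def inner_axis' inner_axis)
  have "(\<integral>\<omega>. exp (\<i> * of_real (a \<bullet> X \<omega>)) * of_real (W \<omega> * exp (- (s * (X \<omega> $ k)\<^sup>2 / 2))) \<partial>M)
    = (\<integral>\<omega>. (\<integral>\<xi>. exp (\<i> * of_real ((a + (t * \<xi>) *\<^sub>R e) \<bullet> X \<omega>)) * of_real (W \<omega>) \<partial>std_normal_distribution) \<partial>M)"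
  proof (intro Bochner_Integration.integral_cong refl)
    fix \<omega>
    have "(\<integral>\<xi>. exp (\<i> * of_real ((a + (t * \<xi>) *\<^sub>R e) \<bullet> X \<omega>)) * of_real (W \<omega>) \<partial>std_normal_distribution)
      = (\<integral>\<xi>. (exp (\<i> * of_real (a \<bullet> X \<omega>)) * of_real (W \<omega>)) * exp (\<i> * of_real (t * (X \<omega> $ k) * \<xi>)) \<partial>std_normal_distribution)"
      by (intro Bochner_Integration.integral_cong refl)
         (simp add: inner_add_left b4 distrib_left exp_add mult_ac)
    also have "\<dots> = (exp (\<i> * of_real (a \<bullet> X \<omega>)) * of_real (W \<omega>)) * char std_normal_distribution (t * (X \<omega> $ k))"
      unfolding char_def integral_mult_right_zero by (simp add: mult_ac)
    finally show "exp (\<i> * of_real (a \<bullet> X \<omega>)) * of_real (W \<omega> * exp (- (s * (X \<omega> $ k)\<^sup>2 / 2)))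
      = (\<integral>\<xi>. exp (\<i> * of_real ((a + (t * \<xi>) *\<^sub>R e) \<bullet> X \<omega>)) * of_real (W \<omega>) \<partial>std_normal_distribution)"
      by (subst eq_commute) (simp add: char_std_normal_distribution power_mult_distrib t)
  qed
  also have "\<dots> = (\<integral>\<xi>. (\<integral>\<omega>. exp (\<i> * of_real ((a + (t * \<xi>) *\<^sub>R e) \<bullet> X \<omega>)) * of_real (W \<omega>) \<partial>M) \<partial>std_normal_distribution)"
  proof (rule Fubini_integral[symmetric])
    show "integrable (M \<Otimes>\<^sub>M std_normal_distribution)
      (\<lambda>(\<omega>, \<xi>). exp (\<i> * of_real ((a + (t * \<xi>) *\<^sub>R e) \<bullet> X \<omega>)) * of_real (W \<omega>))"
    proof (rule integrable_const_bound[where B = 1])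
      show "AE z in M \<Otimes>\<^sub>M std_normal_distribution.
        norm (case z of (\<omega>, \<xi>) \<Rightarrow> exp (\<i> * of_real ((a + (t * \<xi>) *\<^sub>R e) \<bullet> X \<omega>)) * of_real (W \<omega>)) \<le> 1"
        using W01 by (auto simp: norm_mult simp del: of_real_mult)
    qed measurable
  qed
  also have "\<dots> = (\<integral>\<xi>. of_real c * exp (\<i> * of_real (m \<bullet> (a + (t * \<xi>) *\<^sub>R e))
      - of_real ((a + (t * \<xi>) *\<^sub>R e) \<bullet> (C *v (a + (t * \<xi>) *\<^sub>R e)) / 2)) \<partial>std_normal_distribution)"
    using tg by (simp only: tilted_gaussian_def)
  \<comment> \<open>The exponent is sorted by powers of \<xi>: quadratic coefficient
    \<open>s * C $ k $ k\<close>, real linear part \<open>t * b\<close> with \<open>b\<close> the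
    \<open>k\<close>-th entry of \<open>C *v a\<close>, imaginary linear part
    \<open>t * m $ k\<close>.\<close>
  also have "\<dots> = (\<integral>\<xi>. (of_real c * exp (\<i> * of_real (m \<bullet> a) - of_real (a \<bullet> (C *v a) / 2)))
      * exp (complex_of_real (- ((s * C $ k $ k) * \<xi>\<^sup>2 / 2) - (t * b) * \<xi>) + \<i> * of_real ((t * m $ k) * \<xi>)) \<partial>std_normal_distribution)"
  proof (intro Bochner_Integration.integral_cong refl)
    fix \<xi>
    have 1: "(a + (t * \<xi>) *\<^sub>R e) \<bullet> (C *v (a + (t * \<xi>) *\<^sub>R e))
      = a \<bullet> (C *v a) + 2 * (t * \<xi>) * b + s * \<xi>\<^sup>2 * C $ k $ k"
      by (simp add: matrix_vector_right_distrib matrix_vector_mult_scaleR inner_add_left inner_add_right b1 b2 b3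
        t[symmetric] power2_eq_square algebra_simps)
    have 2: "m \<bullet> (a + (t * \<xi>) *\<^sub>R e) = m \<bullet> a + t * m $ k * \<xi>"
      by (simp add: inner_add_right b4)
    show "of_real c * exp (\<i> * of_real (m \<bullet> (a + (t * \<xi>) *\<^sub>R e))
      - of_real ((a + (t * \<xi>) *\<^sub>R e) \<bullet> (C *v (a + (t * \<xi>) *\<^sub>R e)) / 2))
      = (of_real c * exp (\<i> * of_real (m \<bullet> a) - of_real (a \<bullet> (C *v a) / 2)))
      * exp (complex_of_real (- ((s * C $ k $ k) * \<xi>\<^sup>2 / 2) - (t * b) * \<xi>) + \<i> * of_real ((t * m $ k) * \<xi>))"
      unfolding 1 2 mult.assoc exp_add[symmetric] 
      by (rule arg_cong[where f = "\<lambda>z. of_real c * exp z"])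
         (simp add: field_simps)
  qed
  also have "\<dots> = (of_real c * exp (\<i> * of_real (m \<bullet> a) - of_real (a \<bullet> (C *v a) / 2)))
      * (of_real (exp (((t * b)\<^sup>2 - (t * m $ k)\<^sup>2) / (2 * p)) / sqrt p) * exp (- \<i> * of_real ((t * b) * (t * m $ k) / p)))"
    unfolding integral_mult_right_zero p_def
    by (subst gaussian_integral_linear) (use s Ck in auto)
  also have "\<dots> = of_real (c * exp (- (s * (m $ k)\<^sup>2 / (2 * p))) / sqrt p)
      * exp (\<i> * of_real (m \<bullet> a - s * m $ k * b / p) - of_real ((a \<bullet> (C *v a) - s * b\<^sup>2 / p) / 2))"
  proof -
    have "exp (\<i> * complex_of_real (m \<bullet> a) - of_real (a \<bullet> (C *v a) / 2))
      * (of_real (exp (((t * b)\<^sup>2 - (t * m $ k)\<^sup>2) / (2 * p))) * exp (- \<i> * of_real ((t * b) * (t * m $ k) / p)))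
      = of_real (exp (- (s * (m $ k)\<^sup>2 / (2 * p))))
      * exp (\<i> * of_real (m \<bullet> a - s * m $ k * b / p) - of_real ((a \<bullet> (C *v a) - s * b\<^sup>2 / p) / 2))"
      unfolding exp_of_real[symmetric] exp_add[symmetric] power_mult_distrib t
      by (rule arg_cong[where f = exp])
         (simp add: t[symmetric] power2_eq_square diff_divide_distrib right_diff_distrib mult_ac)
    then show ?thesis by (simp add: mult_ac)
  qed
  finally show "(\<integral>\<omega>. exp (\<i> * of_real (a \<bullet> X \<omega>)) * of_real (W \<omega> * exp (- (s * (X \<omega> $ k)\<^sup>2 / 2))) \<partial>M)
    = of_real (tilted_mass s k C m c) * exp (\<i> * of_real (tilted_mean s k C m \<bullet> a) - of_real (a \<bullet> (tilted_cov s k C *v a) / 2))"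
    unfolding inner_tilted_cov inner_tilted_mean tilted_mass_def b_def p_def .
qed

section \<open>Inverses of positive definite matrices and their diagonal perturbations\<close>

lemma matrix_inv_eqI:
  fixes A B :: "'a::field^'n^'n"
  assumes "A ** B = mat 1"
  shows "matrix_inv A = B"
proof -
  have BA: "B ** A = mat 1" using assms matrix_left_right_inverse by blast
  \<comment> \<open>\<open>matrix_inv\<close> chooses some two-sided inverse; the witness
    \<open>B\<close> shows that there is one.\<close>
  have "A ** matrix_inv A = mat 1 \<and> matrix_inv A ** A = mat 1"
    unfolding matrix_inv_def by (rule someI[of _ B]) (simp add: assms BA)
  then have "matrix_inv A ** A = mat 1" by simp
  then have "(matrix_inv A ** A) ** B = B" by simp
  then show ?thesis by (simp add: assms flip: matrix_mul_assoc)
qed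

text \<open>Definiteness makes the kernel trivial, hence \<open>A\<close> invertible. Transposing
  the inverse relation gives symmetry of the inverse, and its form at x equals the form of
  \<open>A\<close> at the inverse image of x.\<close>

lemma strictly_pos_def_inv:
  fixes A :: "real^'n^'n"
  assumes "strictly_pos_def A"
  shows "A ** matrix_inv A = mat 1" "matrix_inv A ** A = mat 1"
    "A *v (matrix_inv A *v x) = x" "matrix_inv A *v (A *v x) = x"
    "strictly_pos_def (matrix_inv A)"
proof -
  have "\<forall>x. A *v x = 0 \<longrightarrow> x = 0"
    using assms unfolding strictly_pos_def_def by (metis inner_zero_right less_irrefl)
  then obtain B where "B ** A = mat 1" using matrix_left_invertible_ker by blast
  then have AB: "A ** B = mat 1" "B ** A = mat 1" using matrix_left_right_inverse by blast+
  have inv: "matrix_inv A = B" by (rule matrix_inv_eqI) fact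
  show "A ** matrix_inv A = mat 1" "matrix_inv A ** A = mat 1"
    using AB inv by auto
  show Ai: "A *v (matrix_inv A *v x) = x" "matrix_inv A *v (A *v x) = x" for x
    using AB by (simp_all add: inv matrix_vector_mul_assoc)
  have tr: "transpose A = A" using assms by (simp add: strictly_pos_def_def)
  have "A ** transpose B = mat 1"
    using arg_cong[OF AB(2), of transpose] by (simp add: matrix_transpose_mul tr)
  then have "transpose B = B" using matrix_inv_eqI[of A "transpose B"] inv by simp
  moreover have "0 < x \<bullet> (B *v x)" if "x \<noteq> 0" for x
  proof -
    have "B *v x \<noteq> 0" using Ai(1)[of x] that by (auto simp: inv)
    then have "0 < (B *v x) \<bullet> (A *v (B *v x))"
      using assms by (simp add: strictly_pos_def_def)
    then show ?thesis using Ai(1)[of x] by (simp add: inv inner_commute)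
  qed
  ultimately show "strictly_pos_def (matrix_inv A)" by (simp add: inv strictly_pos_def_def)
qed

lemma strictly_pos_def_diag: "strictly_pos_def A \<Longrightarrow> 0 \<le> A $ k $ k"
proof -
  assume "strictly_pos_def A"
  then have "0 < axis k 1 \<bullet> (A *v axis k 1)"
    by (auto simp: strictly_pos_def_def axis_eq_0_iff)
  then show ?thesis by (simp add: inner_axis' matrix_vector_mult_basis column_def)
qed

definition diag_mat :: "real^'n \<Rightarrow> real^'n^'n" where
  "diag_mat l = (\<chi> i j. if i = j then l $ i else 0)"

lemma diag_mat_mult: "(diag_mat l *v x) $ i = l $ i * x $ i"
  by (simp add: diag_mat_def matrix_vector_mult_def if_distrib[of "\<lambda>u. u * _"] cong: if_cong)

lemma diag_mat_add_axis: "(A + diag_mat (l + axis k s)) *v x = (A + diag_mat l) *v x + (s * x $ k) *\<^sub>R axis k 1"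
  by (simp add: vec_eq_iff matrix_vector_mult_add_rdistrib diag_mat_mult axis_def algebra_simps)

lemma strictly_pos_def_add_diag:
  assumes "strictly_pos_def A" "\<And>k. 0 \<le> l $ k"
  shows "strictly_pos_def (A + diag_mat l)"
proof -
  have "transpose (A + diag_mat l) = A + diag_mat l"
    using assms(1) by (simp add: strictly_pos_def_def transpose_def diag_mat_def vec_eq_iff)
  moreover have "0 \<le> x \<bullet> (diag_mat l *v x)" for x
    unfolding inner_vec_def diag_mat_mult
    by (intro sum_nonneg) (simp add: assms(2) mult.left_commute)
  ultimately show ?thesis using assms(1)
    by (simp add: strictly_pos_def_def matrix_vector_mult_add_rdistrib inner_add_right add_pos_nonneg)
qed

lemma tilted_mean_eq: "tilted_mean s k C m = m - (s * m $ k / (1 + s * C $ k $ k)) *\<^sub>R (C *v axis k 1)"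
  by (simp add: tilted_mean_def vec_eq_iff matrix_vector_mult_basis column_def)

text \<open>Covariance and mean are updated by the same linear map. Hence a mean of the form
  \<open>C *v w\<close> keeps this form, with the same \<open>w\<close>, under every update.\<close>

lemma tilted_cov_mult:
  assumes "transpose C = C"
  shows "tilted_cov s k C *v x = tilted_mean s k C (C *v x)"
proof -
  have "C $ i $ j = C $ j $ i" for i j using assms by (metis transpose_def vec_lambda_beta)
  then have Cx: "(C *v x) $ k = (\<Sum>j\<in>UNIV. C $ j $ k * x $ j)"
    by (simp add: matrix_vector_mult_def)
  let ?p = "1 + s * C $ k $ k"
  have "(tilted_cov s k C *v x) $ i = tilted_mean s k C (C *v x) $ i" for i
  proof -
    have "(tilted_cov s k C *v x) $ i = (\<Sum>j\<in>UNIV. C $ i $ j * x $ j - (s * C $ i $ k / ?p) * (C $ j $ k * x $ j))"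
      by (simp add: tilted_cov_def matrix_vector_mult_def left_diff_distrib mult.assoc)
    also have "\<dots> = (C *v x) $ i - (s * C $ i $ k / ?p) * (C *v x) $ k"
      unfolding sum_subtractf sum_distrib_left[symmetric] Cx by (simp add: matrix_vector_mult_def)
    finally show ?thesis by (simp add: tilted_mean_def)
  qed
  then show ?thesis by (simp add: vec_eq_iff)
qed

text \<open>Sherman--Morrison, checked by multiplication: on
  \<open>tilted_mean s k C (C *v x)\<close> the old matrix yields x minus a multiple of
  \<open>axis k 1\<close>, and the new diagonal entry adds exactly this multiple back.\<close>

lemma matrix_inv_add_axis:
  fixes A :: "real^'n^'n"
  assumes A: "strictly_pos_def A" and l: "\<And>k. 0 \<le> l $ k" and s: "0 \<le> s"
  defines "C \<equiv> matrix_inv (A + diag_mat l)"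
  shows "matrix_inv (A + diag_mat (l + axis k s)) = tilted_cov s k C"
    "matrix_inv (A + diag_mat (l + axis k s)) *v w = tilted_mean s k C (C *v w)"
proof -
  let ?B = "A + diag_mat l"
  have B: "strictly_pos_def ?B" by (rule strictly_pos_def_add_diag[OF A l])
  note inv = strictly_pos_def_inv[OF B, folded C_def]
  have sym: "transpose C = C" using inv(5) by (simp add: strictly_pos_def_def)
  have p: "1 + s * C $ k $ k > 0" using strictly_pos_def_diag[OF inv(5), of k] s by (simp add: add_pos_nonneg)
  have "(A + diag_mat (l + axis k s)) *v tilted_mean s k C (C *v x) = x" for x
  proof -
    let ?y = "(C *v x) $ k"
    have "(C *v axis k 1) $ k = C $ k $ k"
      by (simp add: matrix_vector_mult_basis column_def)
    then have "s * tilted_mean s k C (C *v x) $ k = s * ?y / (1 + s * C $ k $ k)"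
      using p by (simp add: tilted_mean_eq field_simps)
    then have "(A + diag_mat (l + axis k s)) *v tilted_mean s k C (C *v x)
      = ?B *v tilted_mean s k C (C *v x) + (s * ?y / (1 + s * C $ k $ k)) *\<^sub>R axis k 1"
      unfolding diag_mat_add_axis by simp
    also have "?B *v tilted_mean s k C (C *v x) = x - (s * ?y / (1 + s * C $ k $ k)) *\<^sub>R axis k 1"
      unfolding tilted_mean_eq matrix_vector_mult_diff_distrib matrix_vector_mult_scaleR inv ..
    finally show ?thesis by simp
  qed
  then have "(A + diag_mat (l + axis k s)) ** tilted_cov s k C = mat 1"
    by (simp add: matrix_eq matrix_vector_mul_assoc[symmetric] tilted_cov_mult[OF sym])
  then show 1: "matrix_inv (A + diag_mat (l + axis k s)) = tilted_cov s k C"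
    by (rule matrix_inv_eqI)
  show "matrix_inv (A + diag_mat (l + axis k s)) *v w = tilted_mean s k C (C *v w)"
    unfolding 1 by (rule tilted_cov_mult[OF sym])
qed

section \<open>Gaussian vectors weighted in all coordinates\<close>

definition sq_weight :: "real^'n \<Rightarrow> real^'n \<Rightarrow> real" where
  "sq_weight l x = exp (- ((\<Sum>i\<in>UNIV. l $ i * (x $ i)\<^sup>2) / 2))"

lemma sq_weight_add_axis: "sq_weight (l + axis k s) x = sq_weight l x * exp (- (s * (x $ k)\<^sup>2 / 2))"
  by (simp add: sq_weight_def axis_def distrib_right sum.distrib exp_add[symmetric] add_divide_distrib
      if_distrib[of "\<lambda>u. u * _"] cong: if_cong)

text \<open>The invariant carried through the successive weightings: covariance and mean are
  determined by \<open>l\<close> and a fixed \<open>w\<close>, and only the mass \<open>c\<close>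
  has to be tracked recursively.\<close>

definition tilt :: "'s measure \<Rightarrow> ('s \<Rightarrow> real^'n) \<Rightarrow> real^'n^'n \<Rightarrow> real^'n \<Rightarrow> real^'n \<Rightarrow> real \<Rightarrow> bool" where
  "tilt M X A w l c \<longleftrightarrow> tilted_gaussian M X (\<lambda>\<omega>. sq_weight l (X \<omega>)) c
     (matrix_inv (A + diag_mat l) *v w) (matrix_inv (A + diag_mat l))"

lemma tilt_step:
  fixes X :: "'s \<Rightarrow> real^'n"
  assumes M: "prob_space M" "X \<in> borel_measurable M"
    and A: "strictly_pos_def A" and l: "\<And>k. 0 \<le> l $ k" and s: "0 \<le> s"
    and tilt: "tilt M X A w l c"
  defines "C \<equiv> matrix_inv (A + diag_mat l)"
  shows "tilt M X A w (l + axis k s) (tilted_mass s k C (C *v w) c)"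
proof -
  note [measurable] = M(2)
  have C: "strictly_pos_def C"
    unfolding C_def by (intro strictly_pos_def_inv strictly_pos_def_add_diag A l)
  have "tilted_gaussian M X (\<lambda>\<omega>. sq_weight l (X \<omega>) * exp (- (s * (X \<omega> $ k)\<^sup>2 / 2)))
    (tilted_mass s k C (C *v w) c) (tilted_mean s k C (C *v w)) (tilted_cov s k C)"
  proof (rule tilted_gaussian_step[OF M])
    show "(\<lambda>\<omega>. sq_weight l (X \<omega>)) \<in> borel_measurable M"
      unfolding sq_weight_def by simp
    show "sq_weight l (X \<omega>) \<le> 1" for \<omega>
      by (auto simp: sq_weight_def l intro!: sum_nonneg)
    show "tilted_gaussian M X (\<lambda>\<omega>. sq_weight l (X \<omega>)) c (C *v w) C"
      using tilt by (simp add: tilt_def C_def)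
    show "transpose C = C" using C by (simp add: strictly_pos_def_def)
    show "0 \<le> C $ k $ k" by (rule strictly_pos_def_diag[OF C])
  qed (simp_all add: s sq_weight_def)
  then show ?thesis
    unfolding tilt_def sq_weight_add_axis
    unfolding matrix_inv_add_axis(2)[OF A l s, folded C_def]
    unfolding matrix_inv_add_axis(1)[OF A l s, folded C_def] .
qed

text \<open>The transform at a = 0. It identifies \<open>c\<close> as a value of the Laplace
  transform of the squares.\<close>

lemma tilt_mass:
  assumes "tilt M X A w l c"
  shows "(\<integral>\<omega>. sq_weight l (X \<omega>) \<partial>M) = c"
proof -
  have "(\<integral>\<omega>. exp (\<i> * of_real (0 \<bullet> X \<omega>)) * of_real (sq_weight l (X \<omega>)) \<partial>M) = complex_of_real c"
    using assms[unfolded tilt_def tilted_gaussian_def, rule_format, of 0] by simp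
  then have "complex_of_real (\<integral>\<omega>. sq_weight l (X \<omega>) \<partial>M) = complex_of_real c"
    by simp
  then show ?thesis by (simp only: of_real_eq_iff)
qed

text \<open>The starting point, without weight. The projection of \<open>G\<close> on
  \<open>a\<close> is normal, and rescaling it to variance 1 gives its characteristic function; a =
  0 is separate because the projection then has no density.\<close>

lemma tilted_gaussian_shift:
  fixes G :: "'s \<Rightarrow> real^'n"
  assumes G: "centered_gaussian_vector M G \<Gamma>" and pd: "strictly_pos_def \<Gamma>"
  shows "tilted_gaussian M (\<lambda>\<omega>. G \<omega> + v) (\<lambda>_. 1) 1 v \<Gamma>"
  unfolding tilted_gaussian_def
proof
  fix a :: "real^'n"
  interpret prob_space M using G by (simp add: centered_gaussian_vector_def)
  have [measurable]: "G \<in> borel_measurable M" using G by (simp add: centered_gaussian_vector_def)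
  have char: "(\<integral>\<omega>. exp (\<i> * of_real (a \<bullet> G \<omega>)) \<partial>M) = of_real (exp (- (a \<bullet> (\<Gamma> *v a) / 2)))"
  proof (cases "a = 0")
    case True
    then show ?thesis by (simp add: prob_space)
  next
    case False
    define \<sigma> where "\<sigma> = sqrt (a \<bullet> (\<Gamma> *v a))"
    have pos: "0 < a \<bullet> (\<Gamma> *v a)" using pd False by (simp add: strictly_pos_def_def)
    then have \<sigma>: "0 < \<sigma>" "\<sigma>\<^sup>2 = a \<bullet> (\<Gamma> *v a)" by (simp_all add: \<sigma>_def)
    have "distributed M lborel (\<lambda>\<omega>. a \<bullet> G \<omega>) (\<lambda>x. ennreal (normal_density 0 \<sigma> x))"
      using G pos by (simp add: centered_gaussian_vector_def \<sigma>_def)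
    then have "distributed M lborel (\<lambda>\<omega>. (a \<bullet> G \<omega> - 0) / \<sigma>) (\<lambda>x. ennreal (std_normal_density x))"
      by (rule normal_standard_normal_convert[OF \<sigma>(1), THEN iffD1])
    then have d: "distr M lborel (\<lambda>\<omega>. (a \<bullet> G \<omega>) / \<sigma>) = std_normal_distribution"
      by (simp add: distributed_distr_eq_density)
    have "of_real (exp (- (\<sigma>\<^sup>2 / 2))) = char std_normal_distribution \<sigma>"
      by (simp add: char_std_normal_distribution)
    also have "\<dots> = (\<integral>\<omega>. exp (\<i> * of_real (\<sigma> * ((a \<bullet> G \<omega>) / \<sigma>))) \<partial>M)"
      unfolding char_def d[symmetric] by (subst integral_distr) (auto simp: measurable_lborel1)
    finally show ?thesis using \<sigma> by simp
  qed
  have "(\<integral>\<omega>. exp (\<i> * of_real (a \<bullet> (G \<omega> + v))) * of_real 1 \<partial>M)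
    = (\<integral>\<omega>. exp (\<i> * of_real (v \<bullet> a)) * exp (\<i> * of_real (a \<bullet> G \<omega>)) \<partial>M)"
  proof -
    have "a \<bullet> (G \<omega> + v) = v \<bullet> a + a \<bullet> G \<omega>" for \<omega>
      by (simp add: inner_add_right inner_commute[of v])
    then show ?thesis by (simp add: distrib_left exp_add)
  qed
  also have "\<dots> = of_real 1 * exp (\<i> * of_real (v \<bullet> a) - of_real (a \<bullet> (\<Gamma> *v a) / 2))"
    unfolding integral_mult_right_zero char 
    by (simp only: diff_conv_add_uminus exp_add of_real_minus[symmetric] exp_of_real of_real_1 mult_1)
  finally show "(\<integral>\<omega>. exp (\<i> * of_real (a \<bullet> (G \<omega> + v))) * of_real 1 \<partial>M)
    = of_real 1 * exp (\<i> * of_real (v \<bullet> a) - of_real (a \<bullet> (\<Gamma> *v a) / 2))" .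
qed

lemma tilted_mass_pos:
  assumes "0 < c" "0 \<le> s" "0 \<le> C $ k $ k"
  shows "0 < tilted_mass s k C m c"
  using assms by (simp add: tilted_mass_def add_pos_nonneg)

lemma ln_tilted_mass:
  assumes "0 < c" "0 \<le> s" "0 \<le> C $ k $ k"
  shows "ln (tilted_mass s k C m c)
    = ln c - (s * (m $ k)\<^sup>2 / (1 + s * C $ k $ k) + ln (1 + s * C $ k $ k)) / 2"
proof -
  have "0 < 1 + s * C $ k $ k" using assms by (simp add: add_pos_nonneg)
  then show ?thesis using assms
    by (simp add: tilted_mass_def ln_div ln_mult ln_sqrt add_divide_distrib)
qed

text \<open>Induction on the set of coordinates where the weight is switched on, from mass 1 at
  weight 0, where the mean is v because the inverse of \<open>matrix_inv \<Gamma>\<close> is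
  \<Gamma>.\<close>

lemma tilt_exists:
  fixes G :: "'s \<Rightarrow> real^'n"
  assumes G: "centered_gaussian_vector M G \<Gamma>" and pd: "strictly_pos_def \<Gamma>"
    and l: "\<And>k. 0 \<le> l $ k"
  shows "\<exists>c>0. tilt M (\<lambda>\<omega>. G \<omega> + v) (matrix_inv \<Gamma>) (matrix_inv \<Gamma> *v v) l c"
proof -
  let ?A = "matrix_inv \<Gamma>"
  let ?r = "\<lambda>S. \<chi> k. if k \<in> S then l $ k else 0"
  have A: "strictly_pos_def ?A" using strictly_pos_def_inv[OF pd] by simp
  have AA: "matrix_inv ?A = \<Gamma>" using strictly_pos_def_inv(2)[OF pd] by (rule matrix_inv_eqI)
  have M: "prob_space M" "(\<lambda>\<omega>. G \<omega> + v) \<in> borel_measurable M"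
    using G by (auto simp: centered_gaussian_vector_def)
  have "\<exists>c>0. tilt M (\<lambda>\<omega>. G \<omega> + v) ?A (?A *v v) (?r S) c" if "finite S" for S
    using that
  proof induction
    case empty
    have "?r {} = 0" "diag_mat 0 = 0" by (simp_all add: vec_eq_iff diag_mat_def)
    moreover have "tilt M (\<lambda>\<omega>. G \<omega> + v) ?A (?A *v v) 0 1"
      using tilted_gaussian_shift[OF G pd, of v]
      by (simp add: tilt_def sq_weight_def \<open>diag_mat 0 = 0\<close> AA strictly_pos_def_inv[OF pd])
    ultimately show ?case by (intro exI[of _ 1]) simp
  next
    case (insert k S)
    then obtain c where c: "0 < c" "tilt M (\<lambda>\<omega>. G \<omega> + v) ?A (?A *v v) (?r S) c" by blast
    have r: "?r (insert k S) = ?r S + axis k (l $ k)"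
      using insert.hyps by (auto simp: vec_eq_iff axis_def)
    have rS: "0 \<le> ?r S $ j" for j using l by simp
    let ?C = "matrix_inv (?A + diag_mat (?r S))"
    have "strictly_pos_def ?C"
      by (intro strictly_pos_def_inv strictly_pos_def_add_diag A rS)
    then show ?case unfolding r
      using tilt_step[OF M A rS l c(2)] tilted_mass_pos[OF c(1) l strictly_pos_def_diag] by blast
  qed
  from this[of UNIV] show ?thesis by simp
qed

section \<open>An inequality for means and covariances from infinite divisibility\<close>

lemma slope_le:
  fixes u u' v v' :: real
  assumes "\<And>k. 0 < k \<Longrightarrow> k * u' / (1 + k * v') + ln (1 + k * v') \<le> k * u / (1 + k * v) + ln (1 + k * v)"
  shows "u' + v' \<le> u + v"
proof (rule ccontr)
  let ?f = "\<lambda>k. (k * u / (1 + k * v) + ln (1 + k * v)) - (k * u' / (1 + k * v') + ln (1 + k * v'))"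
  assume "\<not> ?thesis"
  then have neg: "(u + v) - (u' + v') < 0" by simp
  \<comment> \<open>Both sides of the assumption vanish at k = 0, where their derivatives are u' +
    v' and u + v. A negative derivative of the difference would violate the assumption for small
    positive k.\<close>
  have "(?f has_real_derivative ((u + v) - (u' + v'))) (at 0)"
    by (auto intro!: derivative_eq_intros)
  from DERIV_neg_dec_right[OF this neg] obtain d where d: "d > 0" "\<And>h. 0 < h \<Longrightarrow> h < d \<Longrightarrow> ?f h < 0"
    by auto
  with d(2)[of "d / 2"] assms[of "d / 2"] show False by simp
qed

text \<open>The mixed difference of the log Laplace transform is taken with step 1 in direction i and
  infinitesimally in direction j.\<close>

lemma inf_divisible_tilt_ineq:
  fixes G :: "'s \<Rightarrow> real^'n" and l v :: "real^'n"
  assumes G: "centered_gaussian_vector M G \<Gamma>" and pd: "strictly_pos_def \<Gamma>"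
    and l: "\<And>k. 0 \<le> l $ k"
    and id: "inf_divisible (distr M borel (\<lambda>\<omega>. \<chi> i. ((G \<omega> + v) $ i)\<^sup>2))"
  defines "C \<equiv> matrix_inv (matrix_inv \<Gamma> + diag_mat l)"
  defines "m \<equiv> C *v (matrix_inv \<Gamma> *v v)"
  shows "0 \<le> (C $ i $ j)\<^sup>2 + 2 * m $ i * m $ j * C $ i $ j"
proof -
  let ?A = "matrix_inv \<Gamma>"
  let ?X = "\<lambda>\<omega>. G \<omega> + v"
  let ?T = "tilt M ?X ?A (?A *v v)"
  define \<nu> where "\<nu> = distr M borel (\<lambda>\<omega>. \<chi> i. (?X \<omega> $ i)\<^sup>2)"
  have A: "strictly_pos_def ?A" using strictly_pos_def_inv[OF pd] by simp
  have M: "prob_space M" "?X \<in> borel_measurable M"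
    using G by (auto simp: centered_gaussian_vector_def)
  have [measurable]: "G \<in> borel_measurable M"
    using G by (auto simp: centered_gaussian_vector_def)
  have sq[measurable]: "(\<lambda>\<omega>. \<chi> i. (?X \<omega> $ i)\<^sup>2) \<in> borel_measurable M"
    by (subst borel_measurable_euclidean_space)
      (auto simp: Basis_vec_def inner_axis simp del: vector_add_component)
  have pos: "AE x in \<nu>. \<forall>k. 0 \<le> x $ k"
    unfolding \<nu>_def using sq by (subst AE_distr_iff) auto
  define \<phi> where "\<phi> l = (\<integral>x. exp (- (l \<bullet> x)) \<partial>\<nu>)" for l
  \<comment> \<open>\<open>sq_weight\<close> contains a factor 1/2 so that \<open>l\<close> itself
    is added to the inverse covariance; the Laplace transform is therefore taken at half of
    \<open>l\<close>.\<close>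
  have mass: "\<phi> ((1 / 2) *\<^sub>R l) = c" if "?T l c" for l c
  proof -
    have "\<phi> ((1 / 2) *\<^sub>R l) = (\<integral>\<omega>. sq_weight l (?X \<omega>) \<partial>M)"
      unfolding \<phi>_def \<nu>_def
      using sq by (subst integral_distr) (auto simp: sq_weight_def inner_vec_def sum_divide_distrib)
    then show ?thesis using tilt_mass[OF that] by simp
  qed
  have C: "strictly_pos_def C"
    unfolding C_def by (intro strictly_pos_def_inv strictly_pos_def_add_diag A l)
  have sym: "C $ a $ b = C $ b $ a" for a b
    using C unfolding strictly_pos_def_def by (metis transpose_def vec_lambda_beta)
  obtain c where c: "0 < c" "?T l c" using tilt_exists[OF G pd l] by blast
  define p where "p = 1 + C $ i $ i"
  have p: "0 < p" using strictly_pos_def_diag[OF C, of i] by (simp add: p_def add_pos_nonneg)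
  let ?l = "l + axis i 1"
  have l': "0 \<le> ?l $ k" for k using l by (simp add: axis_def)
  define C' where "C' = tilted_cov 1 i C"
  define m' where "m' = tilted_mean 1 i C m"
  define c' where "c' = tilted_mass 1 i C m c"
  have C'_inv: "matrix_inv (?A + diag_mat ?l) = C'" "C' *v (?A *v v) = m'"
    using matrix_inv_add_axis[OF A l, of 1 i] by (simp_all add: C'_def m'_def C_def m_def)
  have C': "strictly_pos_def C'"
    unfolding C'_inv(1)[symmetric] by (intro strictly_pos_def_inv strictly_pos_def_add_diag A l')
  have T1: "?T ?l c'"
    using tilt_step[OF M A l _ c(2), of 1 i] by (simp add: c'_def C_def m_def)
  have c': "0 < c'" unfolding c'_def using c strictly_pos_def_diag[OF C] by (simp add: tilted_mass_pos)
  \<comment> \<open>Up to a factor -1/2, these are the slopes at k = 0 of the log mass under a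
    weight k in direction j, after and before the unit weight in direction i.\<close>
  have "(m' $ j)\<^sup>2 + C' $ j $ j \<le> (m $ j)\<^sup>2 + C $ j $ j"
  proof (rule slope_le)
    fix k :: real assume k: "0 < k"
    have T2: "?T (l + axis j k) (tilted_mass k j C m c)"
      using tilt_step[OF M A l _ c(2), of k j] k by (simp add: C_def m_def)
    have T3: "?T (?l + axis j k) (tilted_mass k j C' m' c')"
      using tilt_step[OF M A l' _ T1, of k j] k by (simp add: C'_inv)
    let ?s = "\<lambda>x :: real^'n. (1 / 2) *\<^sub>R x"
    have \<phi>_pos: "0 < \<phi> (?s l)" "0 < \<phi> (?s ?l)" "0 < \<phi> (?s (l + axis j k))" "0 < \<phi> (?s (?l + axis j k))"
      unfolding mass[OF c(2)] mass[OF T1] mass[OF T2] mass[OF T3]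
      using k c c' strictly_pos_def_diag[OF C] strictly_pos_def_diag[OF C'] by (auto intro: tilted_mass_pos)
    have id': "inf_divisible \<nu>" using id by (simp add: \<nu>_def)
    have "ln (\<phi> (?s ?l)) + ln (\<phi> (?s (l + axis j k))) \<le> ln (\<phi> (?s l)) + ln (\<phi> (?s (?l + axis j k)))"
    proof (rule inf_divisible_ln_laplace[OF id' pos, of "?s l" "?s (axis i 1)" "?s (axis j k)",
          folded \<phi>_def scaleR_add_right])
      show "0 \<le> ?s l $ n" "0 \<le> ?s (axis i 1) $ n" "0 \<le> ?s (axis j k) $ n" for n
        using l k by (auto simp: axis_def)
    qed (fact \<phi>_pos)+
    then have "ln c' + ln (tilted_mass k j C m c) \<le> ln c + ln (tilted_mass k j C' m' c')"
      unfolding mass[OF c(2)] mass[OF T1] mass[OF T2] mass[OF T3] .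
    \<comment> \<open>The logarithms of both starting masses cancel, and the factor -1/2 reverses
      the inequality.\<close>
    moreover have "y \<le> x" if "a = c - x / 2" "b = c' - y / 2" "c' + a \<le> c + b" for a b c c' x y :: real
      using that by (simp add: field_simps)
    ultimately show "k * (m' $ j)\<^sup>2 / (1 + k * C' $ j $ j) + ln (1 + k * C' $ j $ j)
      \<le> k * (m $ j)\<^sup>2 / (1 + k * C $ j $ j) + ln (1 + k * C $ j $ j)"
      using ln_tilted_mass[OF c(1) less_imp_le[OF k] strictly_pos_def_diag[OF C], of j m]
      ln_tilted_mass[OF c' less_imp_le[OF k] strictly_pos_def_diag[OF C'], of j m']
      by blast
  qed
  moreover have "m' $ j = m $ j - m $ i * C $ i $ j / p" "C' $ j $ j = C $ j $ j - (C $ i $ j)\<^sup>2 / p"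
    using sym[of j i] by (simp_all add: m'_def C'_def tilted_mean_def tilted_cov_def p_def power2_eq_square)
  ultimately have "(m $ j - m $ i * C $ i $ j / p)\<^sup>2 - (C $ i $ j)\<^sup>2 / p \<le> (m $ j)\<^sup>2" by simp
  \<comment> \<open>The left side is the second-order effect of the finite step in direction i.
    Being a square, it can be bounded below by 0.\<close>
  then have "(m $ i * C $ i $ j / p)\<^sup>2 \<le> ((C $ i $ j)\<^sup>2 + 2 * m $ i * m $ j * C $ i $ j) / p"
    by (simp add: power2_diff add_divide_distrib mult_ac)
  then have "0 \<le> ((C $ i $ j)\<^sup>2 + 2 * m $ i * m $ j * C $ i $ j) / p"
    using zero_le_power2 order_trans by blast
  then show ?thesis using p by (simp add: zero_le_divide_iff)
qed

section \<open>Asymptotics of the resolvent of an M-matrix\<close>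

text \<open>Test \<open>A *v x\<close> against the negative part y of x. The parts y and z have
  disjoint supports, so only off-diagonal entries of \<open>A\<close> enter y \<bullet> Az, which is
  thus at most 0. Hence y \<bullet> Ay is at most 0, and definiteness gives y = 0.\<close>

lemma nonneg_of_mult_nonneg:
  fixes A :: "real^'n^'n"
  assumes A: "strictly_pos_def A" and off: "\<And>i j. i \<noteq> j \<Longrightarrow> A $ i $ j \<le> 0"
    and Ax: "\<And>i. 0 \<le> (A *v x) $ i"
  shows "0 \<le> x $ i"
proof -
  define y where "y = (\<chi> i. max 0 (- x $ i))"
  define z where "z = (\<chi> i. max 0 (x $ i))"
  have x: "x = z - y" by (auto simp: vec_eq_iff y_def z_def max_def)
  have "0 \<le> y \<bullet> (A *v x)"
    unfolding inner_vec_def by (intro sum_nonneg) (simp add: Ax y_def)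
  moreover have "y \<bullet> (A *v z) \<le> 0"
    unfolding inner_vec_def matrix_vector_mult_def
  proof (simp add: sum_distrib_left, intro sum_nonpos)
    fix i j
    show "y $ i * (A $ i $ j * z $ j) \<le> 0"
    proof (cases "i = j")
      case True
      then show ?thesis by (simp add: y_def z_def max_def)
    next
      case False
      then show ?thesis using off[OF False]
        by (simp add: y_def z_def mult_nonneg_nonpos mult_nonpos_nonneg)
    qed
  qed
  ultimately have "y \<bullet> (A *v y) \<le> 0"
    by (simp add: x matrix_vector_mult_diff_distrib inner_diff_right)
  then have "y = 0" using A by (metis not_less strictly_pos_def_def)
  then have "y $ i = 0" by simp
  then show ?thesis by (simp add: y_def max_def split: if_splits)
qed

text \<open>A block decomposition of \<open>A\<close> passes to its inverse: for j in J, the part in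
  I of the j-th column of the inverse is mapped to 0 by \<open>A\<close>, so it vanishes.\<close>

lemma irreducible_mat_inv:
  fixes A :: "real^'n^'n"
  assumes A: "strictly_pos_def A" and irr: "irreducible_mat (matrix_inv A)"
  shows "irreducible_mat A"
  unfolding irreducible_mat_def
proof
  assume "\<exists>I J. I \<noteq> {} \<and> J \<noteq> {} \<and> I \<inter> J = {} \<and> I \<union> J = UNIV \<and>
    (\<forall>i\<in>I. \<forall>j\<in>J. A $ i $ j = 0 \<and> A $ j $ i = 0)"
  then obtain I J where IJ: "I \<noteq> {}" "J \<noteq> {}" "I \<inter> J = {}" "I \<union> J = UNIV"
    and A0': "\<forall>i\<in>I. \<forall>j\<in>J. A $ i $ j = 0 \<and> A $ j $ i = 0"
    by (elim exE conjE)
  have A0: "A $ i $ j = 0" "A $ j $ i = 0" if "i \<in> I" "j \<in> J" for i j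
    using A0' that by simp_all
  have cover: "n \<in> J" if "n \<notin> I" for n using that IJ(4) by blast
  let ?B = "matrix_inv A"
  have B0: "?B $ i $ j = 0" if ij: "i \<in> I" "j \<in> J" for i j
  proof -
    define y where "y = (\<chi> k. if k \<in> I then ?B $ k $ j else 0)"
    have "(A *v y) $ k = 0" for k
    proof (cases "k \<in> I")
      case True
      have "(A *v y) $ k = (\<Sum>n\<in>UNIV. A $ k $ n * ?B $ n $ j)"
      proof -
        have "A $ k $ n * y $ n = A $ k $ n * ?B $ n $ j" for n
          using A0(1)[OF True cover] by (cases "n \<in> I") (simp_all add: y_def)
        then show ?thesis by (simp only: matrix_vector_mult_def vec_lambda_beta)
      qed
      also have "\<dots> = (A ** ?B) $ k $ j" by (simp add: matrix_matrix_mult_def)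
      also have "\<dots> = 0" 
      proof -
        have "k \<noteq> j" using True ij IJ(3) by blast
        then show ?thesis by (simp add: strictly_pos_def_inv(1)[OF A] mat_def)
      qed
      finally show ?thesis .
    next
      case False
      then have "k \<in> J" by (rule cover)
      have "A $ k $ n * y $ n = 0" for n
        using A0(2)[of n k] \<open>k \<in> J\<close> by (simp add: y_def)
      then show ?thesis by (simp only: matrix_vector_mult_def vec_lambda_beta sum.neutral_const)
    qed
    then have "A *v y = 0" by (simp add: vec_eq_iff)
    then have "y = 0" using strictly_pos_def_inv(4)[OF A, of y] by simp
    then have "y $ i = 0" by simp
    then show ?thesis using ij by (simp add: y_def)
  qed
  have sym: "?B $ a $ b = ?B $ b $ a" for a b
    using strictly_pos_def_inv(5)[OF A] unfolding strictly_pos_def_def by (metis transpose_def vec_lambda_beta)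
  have "?B $ i $ j = 0 \<and> ?B $ j $ i = 0" if "i \<in> I" "j \<in> J" for i j
    using B0[OF that] sym[of j i] by simp
  then have "\<not> irreducible_mat ?B"
    unfolding irreducible_mat_def not_not using IJ by (intro exI[of _ I] exI[of _ J]) simp
  then show False using irr by simp
qed

text \<open>Column j of the inverse is nonnegative. In a row k where it vanishes, the terms
  \<open>A $ k $ n * x $ n\<close> are all at most 0 but sum to 0 or 1, so each is 0 and k differs
  from j. The zero set and its complement, which contains j, would then split
  \<open>A\<close>.\<close>

lemma resolvent_pos:
  fixes A :: "real^'n^'n"
  assumes A: "strictly_pos_def A" and off: "\<And>i j. i \<noteq> j \<Longrightarrow> A $ i $ j \<le> 0"
    and irr: "irreducible_mat A" and t: "0 \<le> t"
  shows "0 < matrix_inv (A + diag_mat (\<chi> k. t)) $ i $ j"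
proof (rule ccontr)
  let ?B = "A + diag_mat (\<chi> k. t)"
  assume "\<not> 0 < matrix_inv ?B $ i $ j"
  define x where "x = matrix_inv ?B *v axis j 1"
  have xi: "x $ i = matrix_inv ?B $ i $ j" for i
    by (simp add: x_def matrix_vector_mult_basis column_def)
  have B: "strictly_pos_def ?B" using strictly_pos_def_add_diag[OF A] t by simp
  have Bx: "?B *v x = axis j 1" unfolding x_def by (rule strictly_pos_def_inv(3)[OF B])
  have x: "0 \<le> x $ k" for k
  proof (rule nonneg_of_mult_nonneg[OF B])
    show "?B $ i $ j \<le> 0" if "i \<noteq> j" for i j using off[OF that] that by (simp add: diag_mat_def)
    show "0 \<le> (?B *v x) $ i" for i by (simp add: Bx axis_def)
  qed
  define I where "I = {k. x $ k = 0}"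
  have "i \<in> I" using x[of i] \<open>\<not> _\<close> by (simp add: I_def xi)
  have I: "k \<noteq> j \<and> (\<forall>n. n \<notin> I \<longrightarrow> A $ k $ n = 0)" if "k \<in> I" for k
  proof -
    have le: "A $ k $ n * x $ n \<le> 0" for n
      using that off[of k n] x[of n] by (cases "n = k") (auto simp: I_def mult_nonpos_nonneg)
    \<comment> \<open>The diagonal perturbation contributes \<open>t * x $ k\<close>, which is 0 for
      k in \<open>I\<close>.\<close>
    have "(\<Sum>n\<in>UNIV. A $ k $ n * x $ n) = (?B *v x) $ k"
      using that by (simp add: matrix_vector_mult_add_rdistrib diag_mat_mult I_def) (simp add: matrix_vector_mult_def)
    also have "\<dots> = (if k = j then 1 else 0)" by (simp add: Bx axis_def)
    finally have sum: "(\<Sum>n\<in>UNIV. A $ k $ n * x $ n) = (if k = j then 1 else 0)" .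
    moreover have "(\<Sum>n\<in>UNIV. A $ k $ n * x $ n) \<le> 0" by (intro sum_nonpos le)
    ultimately have "k \<noteq> j" and sum0: "(\<Sum>n\<in>UNIV. A $ k $ n * x $ n) = 0" by (simp_all split: if_splits)
    have "\<forall>n\<in>UNIV. - (A $ k $ n * x $ n) = 0"
      by (rule sum_nonneg_eq_0_iff[THEN iffD1]) (simp_all add: le sum_negf sum0)
    then show ?thesis using \<open>k \<noteq> j\<close> by (auto simp: I_def)
  qed
  have sym: "A $ a $ b = A $ b $ a" for a b
    using A unfolding strictly_pos_def_def by (metis transpose_def vec_lambda_beta)
  have "A $ k $ n = 0 \<and> A $ n $ k = 0" if "k \<in> I" "n \<in> - I" for k n
    using I[OF that(1)] that(2) sym[of n k] by simp
  then have "\<forall>k\<in>I. \<forall>n\<in>- I. A $ k $ n = 0 \<and> A $ n $ k = 0" by blast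
  moreover have "j \<notin> I" using I by blast
  then have "I \<noteq> {}" "- I \<noteq> {}" using \<open>i \<in> I\<close> by blast+
  ultimately have "\<not> irreducible_mat A"
    unfolding irreducible_mat_def not_not by (intro exI[of _ I] exI[of _ "- I"] conjI) simp_all
  then show False using irr by simp
qed

text \<open>Everything rests on t C w = w - A C w. Since C w tends to 0, t C w tends to w. For w the
  j-th unit vector and i different from j, the i-th entry of w drops out; a further factor t gives
  the limit of order t^2.\<close>

lemma tendsto_resolvent:
  fixes A :: "real^'n^'n"
  assumes A: "strictly_pos_def A"
  defines "C \<equiv> \<lambda>t. matrix_inv (A + diag_mat (\<chi> k. t))"
  shows "((\<lambda>t. t *\<^sub>R (C t *v w)) \<longlongrightarrow> w) at_top" (is ?lim)
    and "i \<noteq> j \<Longrightarrow> ((\<lambda>t. t\<^sup>2 * C t $ i $ j) \<longlongrightarrow> - A $ i $ j) at_top"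
proof -
  have B: "strictly_pos_def (A + diag_mat (\<chi> k. t))" if "0 \<le> t" for t
    using strictly_pos_def_add_diag[OF A] that by simp
  have diag: "diag_mat (\<chi> k. t) *v y = t *\<^sub>R y" for t and y :: "real^'n"
    by (simp add: vec_eq_iff diag_mat_mult)
  have res: "t *\<^sub>R (C t *v w) = w - A *v (C t *v w)" if "0 \<le> t" for t w
    using strictly_pos_def_inv(3)[OF B[OF that], of w]
    by (simp add: C_def matrix_vector_mult_add_rdistrib diag algebra_simps)
  \<comment> \<open>Pair t y + A y = w with y, drop the nonnegative y \<bullet> Ay and apply
    Cauchy--Schwarz.\<close>
  have bound: "norm (C t *v w) \<le> norm w / t" if t: "0 < t" for t w
  proof -
    let ?y = "C t *v w"
    have "0 \<le> ?y \<bullet> (A *v ?y)"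
      using A unfolding strictly_pos_def_def by (cases "?y = 0") (auto intro: less_imp_le)
    then have "t * (norm ?y)\<^sup>2 \<le> ?y \<bullet> (t *\<^sub>R ?y) + ?y \<bullet> (A *v ?y)"
      by (simp add: power2_norm_eq_inner)
    also have "\<dots> = ?y \<bullet> w" using res[of t w] t by (simp add: inner_diff_right flip: inner_scaleR_right)
    also have "\<dots> \<le> norm ?y * norm w" by (rule norm_cauchy_schwarz)
    finally have "norm ?y * (t * norm ?y) \<le> norm ?y * norm w" by (simp add: power2_eq_square mult_ac)
    then have "t * norm ?y \<le> norm w" using t by (cases "?y = 0") auto
    then show ?thesis using t by (simp add: field_simps)
  qed
  have lim0: "((\<lambda>t. C t *v w) \<longlongrightarrow> 0) at_top" for w
  proof (rule tendsto_norm_zero_cancel, rule tendsto_sandwich[OF _ _ tendsto_const])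
    show "\<forall>\<^sub>F t in at_top. norm (C t *v w) \<le> norm w / t"
      using eventually_gt_at_top[of 0] by eventually_elim (rule bound)
    show "((\<lambda>t. norm w / t) \<longlongrightarrow> 0) at_top"
      by (intro tendsto_divide_0[OF tendsto_const] filterlim_at_top_imp_at_infinity filterlim_ident)
  qed simp
  have lim: "((\<lambda>t. t *\<^sub>R (C t *v w)) \<longlongrightarrow> w) at_top" for w
  proof -
    have "((\<lambda>t. w - A *v (C t *v w)) \<longlongrightarrow> w - A *v 0) at_top"
      by (intro tendsto_intros bounded_linear.tendsto[OF matrix_vector_mul_bounded_linear] lim0)
    moreover have "\<forall>\<^sub>F t in at_top. w - A *v (C t *v w) = t *\<^sub>R (C t *v w)"
      using eventually_ge_at_top[of 0] by eventually_elim (simp add: res)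
    ultimately show ?thesis by (auto intro: Lim_transform_eventually)
  qed
  then show ?lim .
  assume ij: "i \<noteq> j"
  let ?e = "axis j 1 :: real^'n"
  have "((\<lambda>t. - (A *v (t *\<^sub>R (C t *v ?e))) $ i) \<longlongrightarrow> - (A *v ?e) $ i) at_top"
    by (intro tendsto_intros bounded_linear.tendsto[OF matrix_vector_mul_bounded_linear] lim)
  moreover have "\<forall>\<^sub>F t in at_top. - (A *v (t *\<^sub>R (C t *v ?e))) $ i = t\<^sup>2 * C t $ i $ j"
    using eventually_ge_at_top[of 0]
  proof eventually_elim
    case (elim t)
    have "C t $ i $ j = (C t *v ?e) $ i" by (simp add: matrix_vector_mult_basis column_def)
    moreover have "t * (C t *v ?e) $ i = - (A *v (C t *v ?e)) $ i"
      using arg_cong[OF res[OF elim, of ?e], of "\<lambda>y. y $ i"] ij by (simp add: axis_def)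
    ultimately show ?case
      by (simp add: power2_eq_square mult.assoc matrix_vector_mult_scaleR)
  qed
  ultimately show "((\<lambda>t. t\<^sup>2 * C t $ i $ j) \<longlongrightarrow> - A $ i $ j) at_top"
    by (auto intro: Lim_transform_eventually simp: matrix_vector_mult_basis column_def)
qed

section \<open>The bound on the critical point, by letting the weight tend to infinity\<close>

theorem theorem1p8:
  fixes M :: "'s measure" and G :: "'s \<Rightarrow> real^'n" and \<Gamma> :: "real^'n^'n"
    and \<alpha>0 :: real
  defines "D \<equiv> (\<lambda>i. \<Sum>k\<in>UNIV. matrix_inv \<Gamma> $ i $ k)"
  defines "\<D> \<equiv> {(i, j). D i * D j < 0}"
  assumes gauss: "centered_gaussian_vector M G \<Gamma>"
    and ids: "inf_divisible (shifted_sq_law M G 0)"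
    and pd: "strictly_pos_def \<Gamma>"
    and irr: "irreducible_mat \<Gamma>"
    and M: "M_matrix (matrix_inv \<Gamma>)"
    and nonempty: "\<D> \<noteq> {}"
    and crit: "critical_point M G \<alpha>0"
  shows "\<alpha>0 \<le> (INF p\<in>\<D>. sqrt (matrix_inv \<Gamma> $ fst p $ snd p / (2 * D (fst p) * D (snd p))))"
proof (rule cINF_greatest[OF nonempty])
  fix p assume "p \<in> \<D>"
  obtain i j where p: "p = (i, j)" by force
  have neg: "D i * D j < 0" using \<open>p \<in> \<D>\<close> by (simp add: p \<D>_def)
  \<comment> \<open>For equal indices the product would be a square.\<close>
  then have ij: "i \<noteq> j" by (auto simp: not_less)
  let ?A = "matrix_inv \<Gamma>"
  define v where "v = (\<chi> k. \<alpha>0 :: real^'n)"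
  let ?C = "\<lambda>t. matrix_inv (?A + diag_mat (\<chi> k. t))"
  have A: "strictly_pos_def ?A" and AA: "matrix_inv ?A = \<Gamma>"
    using strictly_pos_def_inv(5)[OF pd] matrix_inv_eqI[OF strictly_pos_def_inv(2)[OF pd]] by auto
  have off: "?A $ i $ j \<le> 0" if "i \<noteq> j" for i j using M that by (simp add: M_matrix_def)
  have irrA: "irreducible_mat ?A" using irreducible_mat_inv[OF A] irr AA by simp
  have Av: "(?A *v v) $ k = \<alpha>0 * D k" for k
    by (simp add: matrix_vector_mult_def v_def D_def sum_distrib_left mult.commute)
  \<comment> \<open>Infinite divisibility holds at the critical value itself, so the shift can be
    exactly \<alpha>0.\<close>
  have "inf_divisible (shifted_sq_law M G \<alpha>0)"
    using crit by (simp add: critical_point_def)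
  then have id: "inf_divisible (distr M borel (\<lambda>\<omega>. \<chi> i. ((G \<omega> + v) $ i)\<^sup>2))"
    by (simp add: shifted_sq_law_def v_def)
  let ?m = "\<lambda>t. ?C t *v (?A *v v)"
  have ineq: "0 \<le> t\<^sup>2 * ?C t $ i $ j + 2 * (t *\<^sub>R ?m t) $ i * (t *\<^sub>R ?m t) $ j" if "0 \<le> t" for t
  proof -
    have "0 < ?C t $ i $ j" by (rule resolvent_pos[OF A off irrA that])
    moreover have "0 \<le> (?C t $ i $ j)\<^sup>2 + 2 * ?m t $ i * ?m t $ j * ?C t $ i $ j"
      using that by (intro inf_divisible_tilt_ineq[OF gauss pd _ id]) simp
    then have "0 \<le> ?C t $ i $ j * (?C t $ i $ j + 2 * ?m t $ i * ?m t $ j)"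
      by (simp add: power2_eq_square algebra_simps)
    ultimately have "0 \<le> ?C t $ i $ j + 2 * ?m t $ i * ?m t $ j" by (simp add: zero_le_mult_iff)
    \<comment> \<open>The factor t^2 is the scale on which both terms converge: the entry of
      \<open>?C t\<close> is of order at most 1/t^2, each mean of order at most 1/t.\<close>
    then have "0 \<le> t\<^sup>2 * (?C t $ i $ j + 2 * ?m t $ i * ?m t $ j)" by simp
    then show ?thesis by (simp add: power2_eq_square algebra_simps)
  qed
  have "((\<lambda>t. t\<^sup>2 * ?C t $ i $ j + 2 * (t *\<^sub>R ?m t) $ i * (t *\<^sub>R ?m t) $ j)
    \<longlongrightarrow> - ?A $ i $ j + 2 * (?A *v v) $ i * (?A *v v) $ j) at_top"
    by (intro tendsto_intros tendsto_resolvent[OF A] ij)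
  then have "0 \<le> - ?A $ i $ j + 2 * (?A *v v) $ i * (?A *v v) $ j"
    by (rule tendsto_lowerbound) (auto intro: eventually_mono[OF eventually_ge_at_top[of 0] ineq] simp del: vector_scaleR_component)
  then have "?A $ i $ j \<le> \<alpha>0\<^sup>2 * (2 * D i * D j)"
    by (simp add: Av power2_eq_square mult_ac)
  \<comment> \<open>Division by the negative number \<open>2 * D i * D j\<close> turns the lower
    bound into an upper bound.\<close>
  then have "\<alpha>0\<^sup>2 \<le> ?A $ i $ j / (2 * D i * D j)"
    using neg by (simp add: neg_le_divide_eq)
  then show "\<alpha>0 \<le> sqrt (?A $ fst p $ snd p / (2 * D (fst p) * D (snd p)))"
    by (simp add: p real_le_rsqrt)
qed

end
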